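(* Let $p$ be a prime, $n=ap^h$ with $h\ge 0$ and $1\le a\le p-1$, and let $k$ be an integer with $1\le k\le n$ and $(p-1)\mid (n-k)$. Then $S(n,k)$ is a minimum zero case, and \[ \nu_p(S(n,k)) = \frac{\sigma_p(k)-\sigma_p(n)}{p-1} = \frac{\sigma_p(k)-a}{p-1}. \]
   Context: $S(n,k)$ is the Stirling number of the second kind, $\nu_p$ the $p$-adic valuation, and $\sigma_p(m)$ the base-$p$ digit sum of $m$. $S(n,k)$ is called a minimum zero case if $\nu_p(S(n,k)) = (\sigma_p(k)-\sigma_p(n))/(p-1)$. *)

theory Defs
  imports Complex_Main "HOL-Computational_Algebra.Primes" "HOL-Combinatorics.Stirling"
begin

(* Base-p digit sum, for p >= 2: the i-th digit of m is m div p^i mod p, and it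
   vanishes for i > m because m < p^i there. *)
definition digit_sum :: "nat \<Rightarrow> nat \<Rightarrow> nat" where
  "digit_sum p m = (\<Sum>i\<le>m. (m div p ^ i) mod p)"

(* The quotient is taken in the reals, so the equation includes the integrality of
   (sigma_p(k) - sigma_p(n)) / (p - 1).  The conjunct Stirling n k > 0 is needed since
   multiplicity p 0 = 0, whereas nu_p(0) is infinite. *)
definition minimum_zero_case :: "nat \<Rightarrow> nat \<Rightarrow> nat \<Rightarrow> bool" where
  "minimum_zero_case p n k \<longleftrightarrow>
     Stirling n k > 0 \<and>
     real (multiplicity p (Stirling n k)) =
       (real (digit_sum p k) - real (digit_sum p n)) / (real p - 1)"

end

theory Submission
  imports Defs
begin

text \<open>
  Write \<open>q = p - 1\<close> and \<open>n = k + r\<close>. Comparing coefficients in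
  \<open>x (e\<^sup>x - 1)\<^sup>k = \<Sum>i. (-1)\<^sup>i / (i + 1) (e\<^sup>x - 1)\<^bsup>k+1+i\<^esup>\<close> (the logarithm series) gives a
  recurrence for \<open>k! S(n, k) / n!\<close>. After scaling by \<open>(-p)\<close> to the power \<open>\<lfloor>r / q\<rfloor>\<close>
  its coefficients become \<open>p\<close>-integral, and if \<open>q\<close> divides \<open>r\<close> then modulo \<open>p\<close>
  only the terms \<open>i = 0\<close> and \<open>i = q\<close> survive. What remains is Pascal's rule, so for \<open>r = q m\<close> the
  scaled number is congruent to \<open>n + m choose m\<close>. For \<open>n = a p\<^sup>h\<close> one has \<open>m < p\<^sup>h\<close>, so
  this binomial coefficient is prime to \<open>p\<close>, and Legendre's formula for \<open>k!\<close> and \<open>n!\<close> yields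
  the valuation of \<open>S(n, k)\<close>.
\<close>

section \<open>Surjection numbers and the logarithm series\<close>

text \<open>The number of surjections from an \<open>n\<close>-set onto a \<open>k\<close>-set;
  divided by \<open>n!\<close> it is the coefficient of \<open>x^n\<close> in
  \<open>(e^x - 1)^k\<close>.\<close>

definition surj_count :: "nat \<Rightarrow> nat \<Rightarrow> rat" where
  "surj_count n k = of_nat (fact k * Stirling n k)"

lemma surj_count_Suc_Suc:
  "surj_count (Suc n) (Suc k) = of_nat (Suc k) * (surj_count n (Suc k) + surj_count n k)"
  by (simp add: surj_count_def algebra_simps)

lemma surj_count_0_Suc [simp]: "surj_count 0 (Suc k) = 0"
  and surj_count_Suc_0 [simp]: "surj_count (Suc n) 0 = 0"
  and surj_count_less: "n < k \<Longrightarrow> surj_count n k = 0"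
  by (simp_all add: surj_count_def)

lemma alternating_sum_telescope:
  fixes A :: "nat \<Rightarrow> rat"
  shows "(\<Sum>i\<le>N. (-1) ^ i * (A i + A (Suc i))) = A 0 + (-1) ^ N * A (Suc N)"
  by (induction N) (simp_all add: algebra_simps)

text \<open>The coefficient comparison is done by induction on \<open>n\<close>. Terms with
  \<open>k + i \<ge> n\<close> vanish, so any \<open>N \<ge> n\<close> will do and the same
  \<open>N\<close> serves the induction hypothesis.\<close>

lemma surj_count_log_series:
  "n \<le> N \<Longrightarrow> of_nat n * surj_count (n - 1) k =
     (\<Sum>i\<le>N. (-1) ^ i / of_nat (Suc i) * surj_count n (Suc (k + i)))"
proof (induction n arbitrary: k)
  case 0
  then show ?case by simp
next
  case (Suc n)
  define A where "A i = surj_count n (k + i)" for i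
  let ?c = "\<lambda>i. (-1) ^ i / of_nat (Suc i) :: rat"
  \<comment> \<open>The factor \<open>Suc (k + i)\<close> of the recurrence splits as
    \<open>(i + 1) + k\<close>: the first summand cancels the denominator and telescopes, the second
    leaves two instances of the induction hypothesis.\<close>
  have split: "?c i * surj_count (Suc n) (Suc (k + i)) =
      (-1) ^ i * (A i + A (Suc i)) + of_nat k * (?c i * A (Suc i)) + of_nat k * (?c i * A i)" for i
  proof -
    have "?c i * surj_count (Suc n) (Suc (k + i)) =
        ?c i * ((of_nat (Suc i) + of_nat k) * (A i + A (Suc i)))"
      by (simp add: surj_count_Suc_Suc A_def algebra_simps)
    also have "\<dots> = ?c i * of_nat (Suc i) * (A i + A (Suc i))
        + of_nat k * (?c i * A (Suc i)) + of_nat k * (?c i * A i)"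
      by (simp only: algebra_simps)
    also have "?c i * of_nat (Suc i) = (-1) ^ i"
      by (simp del: of_nat_Suc)
    finally show ?thesis .
  qed
  have 1: "(\<Sum>i\<le>N. (-1) ^ i * (A i + A (Suc i))) = surj_count n k"
    using Suc.prems unfolding alternating_sum_telescope by (simp add: A_def surj_count_less)
  have 2: "(\<Sum>i\<le>N. ?c i * A (Suc i)) = of_nat n * surj_count (n - 1) k"
    using Suc.IH[of k] Suc.prems by (simp add: A_def)
  have 3: "of_nat k * (\<Sum>i\<le>N. ?c i * A i) = of_nat k * (of_nat n * surj_count (n - 1) (k - 1))"
  proof (cases k)
    case (Suc k')
    then show ?thesis using Suc.IH[of k'] Suc.prems by (simp add: A_def)
  qed simp
  have 4: "of_nat n * surj_count n k =
      of_nat k * (of_nat n * surj_count (n - 1) k) +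
      of_nat k * (of_nat n * surj_count (n - 1) (k - 1))"
  proof (cases n; cases k)
    fix n' k' assume "n = Suc n'" "k = Suc k'"
    then show ?thesis by (simp only: surj_count_Suc_Suc diff_Suc_1 algebra_simps)
  qed simp_all
  have "(\<Sum>i\<le>N. ?c i * surj_count (Suc n) (Suc (k + i))) =
      surj_count n k + of_nat k * (of_nat n * surj_count (n - 1) k)
        + of_nat k * (of_nat n * surj_count (n - 1) (k - 1))"
    unfolding split sum.distrib 1 sum_distrib_left[symmetric] 2 3 ..
  also have "\<dots> = of_nat (Suc n) * surj_count n k"
    using 4 by (simp add: algebra_simps)
  finally show ?case by simp
qed

section \<open>Rational numbers integral at a prime\<close>

text \<open>For prime \<open>p\<close>, the local ring Z_(p) inside the rationals. Fractions need
  not be reduced, so the closure proofs can use any common denominator.\<close>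

definition p_integral :: "nat \<Rightarrow> rat set" where
  "p_integral p = {x. \<exists>a b :: int. \<not> int p dvd b \<and> of_int b * x = of_int a}"

text \<open>Congruence modulo \<open>p\<close> Z_(p). Only the difference has to be integral, which
  is why \<open>p_cong_mult\<close> asks for integrality of one factor on each side.\<close>

definition p_cong :: "nat \<Rightarrow> rat \<Rightarrow> rat \<Rightarrow> bool" where
  "p_cong p x y \<longleftrightarrow> (\<exists>z\<in>p_integral p. x - y = of_nat p * z)"

lemma p_integralI: "\<not> int p dvd b \<Longrightarrow> of_int b * x = of_int a \<Longrightarrow> x \<in> p_integral p"
  unfolding p_integral_def by blast

context
  fixes p :: nat
  assumes prime_p: "prime p"
begin

lemma prime_int_p: "prime (int p)"
  using prime_p by simp

lemma p_integral_of_int [simp]: "of_int a \<in> p_integral p"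
  using prime_int_p by (intro p_integralI[of p 1 _ a]) auto

lemma p_integral_0 [simp]: "0 \<in> p_integral p"
  and p_integral_1 [simp]: "1 \<in> p_integral p"
  and p_integral_of_nat [simp]: "of_nat n \<in> p_integral p"
  using p_integral_of_int[of 0] p_integral_of_int[of 1] p_integral_of_int[of "int n"] by simp_all

lemma p_integral_add [intro]:
  assumes "x \<in> p_integral p" "y \<in> p_integral p"
  shows "x + y \<in> p_integral p"
proof -
  obtain a b c d where h: "\<not> int p dvd b" "of_int b * x = of_int a"
    "\<not> int p dvd d" "of_int d * y = of_int c"
    using assms unfolding p_integral_def by blast
  have "of_int (b * d) * (x + y) = of_int d * (of_int b * x) + of_int b * (of_int d * y)"
    by (simp add: algebra_simps)
  also have "\<dots> = of_int (d * a + b * c)" by (simp add: h)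
  finally show ?thesis
    using h prime_int_p by (intro p_integralI[of p "b * d" _ "d * a + b * c"]) (auto simp: prime_dvd_mult_iff)
qed

lemma p_integral_mult [intro]:
  assumes "x \<in> p_integral p" "y \<in> p_integral p"
  shows "x * y \<in> p_integral p"
proof -
  obtain a b c d where h: "\<not> int p dvd b" "of_int b * x = of_int a"
    "\<not> int p dvd d" "of_int d * y = of_int c"
    using assms unfolding p_integral_def by blast
  have "of_int (b * d) * (x * y) = (of_int b * x) * (of_int d * y)"
    by (simp add: algebra_simps)
  also have "\<dots> = of_int (a * c)" by (simp add: h)
  finally show ?thesis
    using h prime_int_p by (intro p_integralI[of p "b * d" _ "a * c"]) (auto simp: prime_dvd_mult_iff)
qed

lemma p_integral_uminus [intro]: "x \<in> p_integral p \<Longrightarrow> - x \<in> p_integral p"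
  using p_integral_mult[OF p_integral_of_int[of "-1"]] by simp

lemma p_integral_diff [intro]:
  "x \<in> p_integral p \<Longrightarrow> y \<in> p_integral p \<Longrightarrow> x - y \<in> p_integral p"
  using p_integral_add[of x "- y"] p_integral_uminus[of y] by simp

lemma p_integral_power [intro]: "x \<in> p_integral p \<Longrightarrow> x ^ n \<in> p_integral p"
  by (induction n) auto

lemma p_integral_sum [intro]: "(\<And>i. i \<in> A \<Longrightarrow> f i \<in> p_integral p) \<Longrightarrow> sum f A \<in> p_integral p"
  by (induction A rule: infinite_finite_induct) auto

lemma p_integral_inverse: "\<not> p dvd u \<Longrightarrow> 1 / of_nat u \<in> p_integral p"
  by (rule p_integralI[of p "int u" _ 1]) (auto intro: gr0I)

lemma p_cong_refl [simp]: "p_cong p x x"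
  unfolding p_cong_def by (auto intro!: bexI[of _ 0])

lemma p_cong_add:
  assumes "p_cong p x y" "p_cong p x' y'"
  shows "p_cong p (x + x') (y + y')"
proof -
  obtain z z' where "z \<in> p_integral p" "z' \<in> p_integral p"
    "x - y = of_nat p * z" "x' - y' = of_nat p * z'"
    using assms unfolding p_cong_def by blast
  then show ?thesis
    unfolding p_cong_def by (intro bexI[of _ "z + z'"]) (auto simp: algebra_simps)
qed

lemma p_cong_trans:
  assumes "p_cong p x y" "p_cong p y z"
  shows "p_cong p x z"
  using p_cong_add[OF assms] unfolding p_cong_def by (auto simp: algebra_simps)

lemma p_cong_mult:
  assumes "p_cong p x y" "p_cong p x' y'" "x' \<in> p_integral p" "y \<in> p_integral p"
  shows "p_cong p (x * x') (y * y')"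
proof -
  obtain z z' where z: "z \<in> p_integral p" "z' \<in> p_integral p"
    and e: "x = y + of_nat p * z" "x' = y' + of_nat p * z'"
    using assms unfolding p_cong_def by (metis diff_add_cancel add.commute)
  have "x * x' - y * y' = of_nat p * (z * x' + y * z')"
    unfolding e by (simp add: algebra_simps)
  then show ?thesis
    using z assms unfolding p_cong_def by blast
qed

lemma p_cong_sum_0: "(\<And>i. i \<in> A \<Longrightarrow> p_cong p (f i) 0) \<Longrightarrow> p_cong p (sum f A) 0"
proof (induction A rule: infinite_finite_induct)
  case (insert x F)
  then show ?case using p_cong_add[of "f x" 0 "sum f F" 0] by simp
qed simp_all

section \<open>The scaled recurrence\<close>

text \<open>Bernoulli's inequality for \<open>(1 + (p - 1)) ^ v\<close>. With
  \<open>p ^ v \<le> i + 1\<close> it bounds the valuation of \<open>i + 1\<close> by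
  \<open>i / (p - 1)\<close>.\<close>

lemma bernoulli_prime_power: "v * (p - 1) < p ^ v"
proof (induction v)
  case (Suc v)
  have "p - 1 \<le> p ^ v * (p - 1)" using prime_gt_0_nat[OF prime_p] by simp
  then have "Suc v * (p - 1) < p ^ v + p ^ v * (p - 1)"
    using Suc unfolding mult_Suc by linarith
  also have "\<dots> = p ^ v * Suc (p - 1)" by simp
  also have "\<dots> = p ^ Suc v" using prime_gt_0_nat[OF prime_p] by simp
  finally show ?case .
qed simp

text \<open>From exponent 2 on there is room for an extra 1, so \<open>p ^ v \<le> i + 1\<close> and
  \<open>(p - 1) * v = i\<close> together force \<open>v \<le> 1\<close>.\<close>

lemma bernoulli_prime_power_strict:
  assumes "v \<ge> 2"
  shows "Suc (v * (p - 1)) < p ^ v"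
proof -
  obtain w where w: "v = Suc (Suc w)" using assms by (metis add_2_eq_Suc le_Suc_ex)
  have p: "p \<ge> 2" using prime_p prime_ge_2_nat by blast
  have "Suc w * (p - 1) < p ^ Suc w" by (rule bernoulli_prime_power)
  moreover have "p ^ Suc w * (p - 1) \<ge> 2 * (p - 1)"
    using p self_le_power[of p "Suc w"] by (intro mult_right_mono) linarith+
  moreover have "p ^ v = p ^ Suc w + p ^ Suc w * (p - 1)"
    using p w by (cases p) auto
  ultimately show ?thesis using w p unfolding w mult_Suc by linarith
qed

text \<open>The coefficient of the logarithm series times the power of \<open>-p\<close> left over
  when the scaling for \<open>r\<close> is reduced to the scaling for \<open>r - i\<close>.\<close>

definition log_coeff :: "nat \<Rightarrow> nat \<Rightarrow> rat" where
  "log_coeff r i =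
     (-1) ^ i / of_nat (Suc i) * (- of_nat p) ^ (r div (p - 1) - (r - i) div (p - 1))"

lemma divide_Suc_p_integral:
  assumes "Suc i = p ^ v * u" "\<not> p dvd u" "v + d \<le> e"
  obtains z where "z \<in> p_integral p"
    "(-1) ^ i / of_nat (Suc i) * (- of_nat p) ^ e = of_nat p ^ d * z"
proof -
  have p: "p \<noteq> 0" using prime_p by auto
  obtain s where e: "e = v + d + s" using assms(3) le_Suc_ex by blast
  let ?z = "(-1) ^ i * (-1) ^ e * of_nat p ^ s * (1 / of_nat u) :: rat"
  have m1: "(-1 :: rat) \<in> p_integral p" using p_integral_of_int[of "-1"] by simp
  have "?z \<in> p_integral p"
    using assms(2) m1 by (intro p_integral_mult p_integral_power p_integral_inverse) auto
  have "(of_nat (Suc i) :: rat) = of_nat p ^ v * of_nat u"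
    using assms(1) by (metis of_nat_mult of_nat_power)
  moreover have "(- of_nat p) ^ e = ((-1) ^ e * of_nat p ^ e :: rat)"
    by (metis mult_minus1 power_mult_distrib)
  moreover have "(of_nat p :: rat) ^ e = of_nat p ^ v * (of_nat p ^ d * of_nat p ^ s)"
    by (simp add: e power_add mult.assoc)
  ultimately have "(-1) ^ i / of_nat (Suc i) * (- of_nat p) ^ e = of_nat p ^ d * ?z"
    using p by (simp add: field_simps del: of_nat_Suc)
  with \<open>?z \<in> p_integral p\<close> show thesis by (rule that)
qed

lemma div_diff_ge:
  fixes q r i v :: nat
  assumes "q > 0" "i \<le> r" "q * v \<le> i"
  shows "v \<le> r div q - (r - i) div q"
proof -
  have "(r - i) div q + v = (r - i + q * v) div q"
    using assms(1) by simp
  also have "\<dots> \<le> r div q" using assms by (intro div_le_mono) auto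
  finally show ?thesis by simp
qed

text \<open>If \<open>q\<close> divides \<open>r\<close>, the quotient \<open>r div q\<close> is
  exact, so \<open>r - i + q * v < r\<close> already lowers the floor.\<close>

lemma div_diff_gt:
  fixes q r i v :: nat
  assumes "q > 0" "i \<le> r" "q * v < i" "q dvd r"
  shows "v < r div q - (r - i) div q"
proof -
  have "(r - i) div q + v = (r - i + q * v) div q"
    using assms(1) by simp
  also have "\<dots> < r div q" using assms
    by (simp only: div_less_iff_less_mult dvd_div_mult_self)
  finally show ?thesis by simp
qed

lemma pred_prime_pos: "p - 1 > 0"
  using prime_gt_1_nat[OF prime_p] by simp

lemma Suc_prime_decompose:
  obtains v u where "Suc i = p ^ v * u" "\<not> p dvd u" "(p - 1) * v \<le> i" "u > 0"
proof -
  have "Suc i \<noteq> 0" "\<not> is_unit p" using prime_p by auto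
  then obtain u where u: "Suc i = p ^ multiplicity p (Suc i) * u" "\<not> p dvd u"
    using multiplicity_decompose'[of "Suc i" p] by metis
  have "u > 0" using u by (auto intro: gr0I)
  then have "p ^ multiplicity p (Suc i) \<le> Suc i" using u(1) by (metis dvd_imp_le dvd_triv_left zero_less_Suc)
  then have "(p - 1) * multiplicity p (Suc i) \<le> i"
    using bernoulli_prime_power[of "multiplicity p (Suc i)"] by (simp add: mult.commute)
  then show thesis using that u \<open>u > 0\<close> by blast
qed

lemma log_coeff_integral:
  assumes "i \<le> r"
  shows "log_coeff r i \<in> p_integral p"
proof -
  obtain v u where vu: "Suc i = p ^ v * u" "\<not> p dvd u" "(p - 1) * v \<le> i"
    by (rule Suc_prime_decompose)
  have "v + 0 \<le> r div (p - 1) - (r - i) div (p - 1)"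
    using div_diff_ge[OF pred_prime_pos assms vu(3)] by simp
  from divide_Suc_p_integral[OF vu(1,2) this] show ?thesis
    unfolding log_coeff_def by (metis mult_1 power_0)
qed

text \<open>A spare factor \<open>p\<close> survives unless \<open>(p - 1) * v = i\<close> for the
  valuation \<open>v\<close> of \<open>i + 1\<close>. The strict Bernoulli bound leaves only
  \<open>v = 0\<close> and \<open>v = 1\<close> for this, that is, the two excluded values of
  \<open>i\<close>.\<close>

lemma log_coeff_cong_0:
  assumes "i \<le> r" "(p - 1) dvd r" "i \<noteq> 0" "i \<noteq> p - 1"
  shows "p_cong p (log_coeff r i) 0"
proof -
  obtain v u where vu: "Suc i = p ^ v * u" "\<not> p dvd u" "(p - 1) * v \<le> i" "u > 0"
    by (rule Suc_prime_decompose)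
  have "(p - 1) * v \<noteq> i"
  proof
    assume eq: "(p - 1) * v = i"
    have "p ^ v \<le> Suc i" using vu by simp
    then have "\<not> v \<ge> 2" using bernoulli_prime_power_strict[of v] eq by (auto simp: mult.commute)
    then have "v = 0 \<or> v = 1" by auto
    then show False using eq assms by auto
  qed
  then have "v + 1 \<le> r div (p - 1) - (r - i) div (p - 1)"
    using div_diff_gt[OF pred_prime_pos assms(1) _ assms(2), of v] vu(3) by simp
  from divide_Suc_p_integral[OF vu(1,2) this] show ?thesis
    unfolding log_coeff_def p_cong_def by (metis diff_zero power_one_right)
qed

lemma log_coeff_0 [simp]: "log_coeff r 0 = 1"
  by (simp add: log_coeff_def)

lemma log_coeff_pred_prime:
  assumes "p - 1 \<le> r"
  shows "p_cong p (log_coeff r (p - 1)) (-1)"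
proof -
  have p: "p > 0" using prime_p by (simp add: prime_gt_0_nat)
  have "r div (p - 1) - (r - (p - 1)) div (p - 1) = 1"
    using le_div_geq[OF pred_prime_pos assms] by simp
  then have *: "log_coeff r (p - 1) = - ((-1) ^ (p - 1))"
    using p by (simp add: log_coeff_def)
  show ?thesis
  \<comment> \<open>The coefficient is \<open>-1\<close> for odd \<open>p\<close> and
    \<open>1\<close> for \<open>p = 2\<close>, where the two agree modulo 2.\<close>
  proof (cases "p = 2")
    case True
    then have "log_coeff r (p - 1) - (-1) = of_nat p * 1" using * by simp
    then show ?thesis unfolding p_cong_def using p_integral_1 by blast
  next
    case False
    then have "odd p" using prime_p prime_odd_nat prime_ge_2_nat[OF prime_p] by auto
    then have "even (p - 1)" by simp
    then show ?thesis using * by simp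
  qed
qed

section \<open>Integrality and congruences of the scaled surjection numbers\<close>

text \<open>Here \<open>r\<close> stands for \<open>n - k\<close>. The floor exponent clears
  \<open>p\<close> from the denominators, and scaling by \<open>-p\<close> instead of
  \<open>p\<close> gives Pascal's rule its plus sign.\<close>

definition scaled_surj :: "nat \<Rightarrow> nat \<Rightarrow> rat" where
  "scaled_surj r k = (- of_nat p) ^ (r div (p - 1)) * surj_count (k + r) k / fact (k + r)"

lemma scaled_surj_0 [simp]: "scaled_surj 0 k = 1"
  by (simp add: scaled_surj_def surj_count_def)

text \<open>This is the logarithm series at \<open>Suc (k + r)\<close>: all terms share the index
  sum \<open>Suc (k + i) + (r - i)\<close>, hence the same factorial.\<close>

lemma scaled_surj_recurrence:
  "scaled_surj r k = (\<Sum>i\<le>r. log_coeff r i * scaled_surj (r - i) (Suc (k + i)))"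
proof -
  let ?P = "- of_nat p :: rat"
  let ?q = "p - 1"
  have "of_nat (Suc (k + r)) * surj_count (k + r) k =
      (\<Sum>i\<le>Suc (k + r). (-1) ^ i / of_nat (Suc i) * surj_count (Suc (k + r)) (Suc (k + i)))"
    using surj_count_log_series[of "Suc (k + r)" "Suc (k + r)" k] by simp
  also have "\<dots> = (\<Sum>i\<le>r. (-1) ^ i / of_nat (Suc i) * surj_count (Suc (k + r)) (Suc (k + i)))"
    by (rule sum.mono_neutral_right) (auto simp: surj_count_less)
  finally have log: "of_nat (Suc (k + r)) * surj_count (k + r) k = \<dots>" .
  have "scaled_surj r k =
      ?P ^ (r div ?q) / fact (Suc (k + r)) * (of_nat (Suc (k + r)) * surj_count (k + r) k)"
    by (simp add: scaled_surj_def del: of_nat_Suc)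
  also have "\<dots> = (\<Sum>i\<le>r. ?P ^ (r div ?q) / fact (Suc (k + r)) *
      ((-1) ^ i / of_nat (Suc i) * surj_count (Suc (k + r)) (Suc (k + i))))"
    unfolding log sum_distrib_left ..
  also have "\<dots> = (\<Sum>i\<le>r. log_coeff r i * scaled_surj (r - i) (Suc (k + i)))"
  proof (rule sum.cong)
    fix i assume "i \<in> {..r}"
    then have "i \<le> r" by simp
    then have "?P ^ (r div ?q) =
        ?P ^ (r div ?q - (r - i) div ?q) * ?P ^ ((r - i) div ?q)"
      by (subst power_add[symmetric]) (simp add: div_le_mono)
    moreover have "Suc (k + i) + (r - i) = Suc (k + r)" using \<open>i \<le> r\<close> by simp
    ultimately show "?P ^ (r div ?q) / fact (Suc (k + r)) *
        ((-1) ^ i / of_nat (Suc i) * surj_count (Suc (k + r)) (Suc (k + i))) =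
        log_coeff r i * scaled_surj (r - i) (Suc (k + i))"
      by (simp add: log_coeff_def scaled_surj_def mult_ac del: of_nat_Suc fact_Suc)
  qed simp
  finally show ?thesis .
qed

lemma scaled_surj_step:
  "scaled_surj r (Suc k) =
     scaled_surj r k - (\<Sum>i\<in>{1..r}. log_coeff r i * scaled_surj (r - i) (Suc (k + i)))"
proof -
  have "{..r} = insert 0 {1..r}" by auto
  then show ?thesis using scaled_surj_recurrence[of r k] by simp
qed

lemma scaled_surj_right_0 [simp]: "r > 0 \<Longrightarrow> scaled_surj r 0 = 0"
  by (cases r) (simp_all add: scaled_surj_def)

lemma scaled_surj_integral: "scaled_surj r k \<in> p_integral p"
\<comment> \<open>In \<open>scaled_surj_step\<close> the sum reaches beyond \<open>k\<close> but
  only at smaller \<open>r\<close>, so the outer induction keeps \<open>k\<close> arbitrary; the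
  inner one on \<open>k\<close> handles the term with the same \<open>r\<close>.\<close>
proof (induction r arbitrary: k rule: less_induct)
  case (less r)
  show ?case
  proof (induction k)
    case 0
    show ?case by (cases "r = 0") auto
  next
    case (Suc k)
    have "(\<Sum>i\<in>{1..r}. log_coeff r i * scaled_surj (r - i) (Suc (k + i))) \<in> p_integral p"
      by (intro p_integral_sum p_integral_mult log_coeff_integral less) auto
    then show ?case unfolding scaled_surj_step[of r k] using Suc by auto
  qed
qed

text \<open>Modulo \<open>p\<close> the sum in \<open>scaled_surj_step\<close> reduces to its term
  \<open>i = p - 1\<close>, whose coefficient is \<open>-1\<close>.\<close>

lemma scaled_surj_cong_Pascal:
  assumes "(p - 1) dvd r" "p - 1 \<le> r"
  shows "p_cong p (scaled_surj r (Suc k)) (scaled_surj r k + scaled_surj (r - (p - 1)) (k + p))"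
proof -
  let ?t = "\<lambda>i. log_coeff r i * scaled_surj (r - i) (Suc (k + i))"
  let ?s = "scaled_surj (r - (p - 1)) (k + p)"
  have p: "Suc (k + (p - 1)) = k + p" using pred_prime_pos by simp
  have "p_cong p (sum ?t ({1..r} - {p - 1})) 0"
  proof (rule p_cong_sum_0)
    fix i assume "i \<in> {1..r} - {p - 1}"
    then have "p_cong p (?t i) (0 * scaled_surj (r - i) (Suc (k + i)))"
      by (intro p_cong_mult log_coeff_cong_0 assms scaled_surj_integral) auto
    then show "p_cong p (?t i) 0" by simp
  qed
  moreover have "p_cong p (?t (p - 1)) (- 1 * ?s)"
    unfolding p using p_integral_of_int[of "-1"]
    by (intro p_cong_mult log_coeff_pred_prime assms scaled_surj_integral) auto
  moreover have "sum ?t {1..r} = ?t (p - 1) + sum ?t ({1..r} - {p - 1})"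
    using assms(2) pred_prime_pos by (intro sum.remove) auto
  ultimately have "p_cong p (sum ?t {1..r}) (- ?s)"
    using p_cong_add by fastforce
  moreover have "sum ?t {1..r} \<in> p_integral p"
    by (intro p_integral_sum p_integral_mult log_coeff_integral scaled_surj_integral) simp
  ultimately have "p_cong p (-1 * sum ?t {1..r}) (-1 * - ?s)"
    using p_integral_of_int[of "-1"] by (intro p_cong_mult) simp_all
  from p_cong_add[OF p_cong_refl[of "scaled_surj r k"] this] show ?thesis
    by (simp only: scaled_surj_step[of r k] mult_minus1 add_uminus_conv_diff minus_minus)
qed

text \<open>Both sides obey the same Pascal recursion, since
  \<open>k + p + p * m = k + p * Suc m\<close>, and for positive \<open>m\<close> both vanish modulo
  \<open>p\<close> at the boundary \<open>k = 0\<close>.\<close>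

lemma scaled_surj_cong_binomial:
  "p_cong p (scaled_surj ((p - 1) * m) k) (of_nat ((k + p * m) choose m))"
proof (induction m arbitrary: k)
  case 0
  then show ?case by simp
next
  case (Suc m)
  note IH = Suc.IH
  show ?case
  proof (induction k)
    case 0
    \<comment> \<open>Absorption exhibits the factor \<open>p\<close> of the boundary binomial,
      since \<open>Suc m\<close> cancels.\<close>
    have "Suc m * (p * Suc m choose Suc m) = p * Suc m * (p * Suc m - 1 choose m)"
      using times_binomial_minus1_eq[of "Suc m" "p * Suc m"] unfolding diff_Suc_1 by blast
    also have "\<dots> = Suc m * (p * (p * Suc m - 1 choose m))"
      by (simp only: mult.assoc mult.left_commute)
    finally have "(p * Suc m choose Suc m) = p * (p * Suc m - 1 choose m)"
      unfolding Suc_mult_cancel1 .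
    then have "(0 :: rat) - of_nat (p * Suc m choose Suc m) =
        of_nat p * - of_nat (p * Suc m - 1 choose m)"
      by (simp only: of_nat_mult diff_0 mult_minus_right)
    then have "p_cong p 0 (of_nat (p * Suc m choose Suc m))"
      unfolding p_cong_def by (rule bexI) (intro p_integral_uminus p_integral_of_nat)
    moreover have "scaled_surj ((p - 1) * Suc m) 0 = 0"
      using pred_prime_pos by (intro scaled_surj_right_0) simp
    ultimately show ?case by (simp only: add_0)
  next
    case (Suc k)
    let ?r = "(p - 1) * Suc m"
    have "p_cong p (scaled_surj ?r (Suc k)) (scaled_surj ?r k + scaled_surj (?r - (p - 1)) (k + p))"
      by (rule scaled_surj_cong_Pascal) auto
    moreover have r: "?r - (p - 1) = (p - 1) * m" by simp
    ultimately have "p_cong p (scaled_surj ?r (Suc k))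
        (scaled_surj ?r k + scaled_surj ((p - 1) * m) (k + p))"
      by (simp only: r)
    moreover have "p_cong p (scaled_surj ?r k + scaled_surj ((p - 1) * m) (k + p))
        (of_nat (k + p * Suc m choose Suc m) + of_nat (k + p + p * m choose m))"
      by (rule p_cong_add[OF Suc.IH IH])
    ultimately have "p_cong p (scaled_surj ?r (Suc k))
        (of_nat (k + p * Suc m choose Suc m) + of_nat (k + p + p * m choose m))"
      by (rule p_cong_trans)
    moreover have "k + p + p * m = k + p * Suc m" "Suc k + p * Suc m = Suc (k + p * Suc m)"
      by simp_all
    ultimately show ?case by (simp only: binomial_Suc_Suc of_nat_add add.commute)
  qed
qed

section \<open>Valuations\<close>

text \<open>Adding \<open>n\<close> and \<open>m\<close> in base \<open>p\<close> produces no carry.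
  The induction uses \<open>(m+1) C(n+m+1, m+1) = (n+m+1) C(n+m, m)\<close>, where
  \<open>m+1\<close> and \<open>n+m+1\<close> have the same valuation.\<close>

lemma not_dvd_binomial_add:
  assumes "p ^ h dvd n" "m < p ^ h"
  shows "\<not> p dvd (n + m choose m)"
  using assms(2)
proof (induction m)
  case 0
  then show ?case using prime_p by auto
next
  case (Suc m)
  let ?v = "multiplicity p (Suc m)"
  have "p ^ ?v \<le> Suc m" by (intro dvd_imp_le multiplicity_dvd) simp
  then have "p ^ ?v < p ^ h" using Suc.prems by simp
  then have "Suc ?v \<le> h" using prime_gt_1_nat[OF prime_p] by simp
  then have n: "p ^ Suc ?v dvd n" using assms(1) le_imp_power_dvd dvd_trans by blast
  then have n': "p ^ ?v dvd n" using le_imp_power_dvd[of ?v "Suc ?v" p] dvd_trans by auto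
  have "\<not> p ^ Suc ?v dvd Suc m"
    using prime_p by (subst power_dvd_iff_le_multiplicity) auto
  then have "multiplicity p (n + Suc m) = ?v"
    using n n' by (intro multiplicity_eqI) (auto simp: multiplicity_dvd dvd_add_right_iff simp del: power_Suc add_Suc_right)
  moreover have "multiplicity p (Suc (n + m) * (n + m choose m)) =
      multiplicity p ((Suc (n + m) choose Suc m) * Suc m)"
    by (simp only: Suc_times_binomial_eq)
  ultimately have "multiplicity p (n + m choose m) = multiplicity p (n + Suc m choose Suc m)"
    using prime_p by (subst (asm) (1 2) prime_elem_multiplicity_mult_distrib) auto
  moreover have "\<not> p dvd (n + m choose m)" using Suc by simp
  ultimately have "multiplicity p (n + Suc m choose Suc m) = 0"
    by (simp add: not_dvd_imp_multiplicity_0)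
  then show ?case
    using prime_p by (subst (asm) multiplicity_eq_zero_iff) auto
qed

lemma multiplicity_of_nat_int: "n \<noteq> 0 \<Longrightarrow> multiplicity (int p) (int n) = multiplicity p n"
proof (rule multiplicity_eqI)
  assume "n \<noteq> 0"
  then have "\<not> p ^ Suc (multiplicity p n) dvd n"
    using prime_p by (subst power_dvd_iff_le_multiplicity) auto
  then show "\<not> int p ^ Suc (multiplicity p n) dvd int n"
    by (metis int_dvd_int_iff of_nat_power)
  show "int p ^ multiplicity p n dvd int n"
    by (metis int_dvd_int_iff of_nat_power multiplicity_dvd)
qed

text \<open>The congruence gives \<open>(-p)^m k! S(n,k) = n! u\<close>, where \<open>u\<close> is a
  unit at \<open>p\<close> because its residue is that of the binomial coefficient. Comparing
  valuations does the rest.\<close>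

lemma multiplicity_fact_Stirling:
  assumes "\<not> p dvd (k + p * m choose m)"
  defines "n \<equiv> k + (p - 1) * m"
  shows "Stirling n k > 0"
    and "multiplicity p (fact n) = m + multiplicity p (fact k) + multiplicity p (Stirling n k)"
proof -
  let ?C = "k + p * m choose m"
  have P: "prime_elem (int p)" and p0: "p \<noteq> 0" using prime_int_p prime_p by auto
  obtain z where z: "z \<in> p_integral p" "scaled_surj ((p - 1) * m) k - of_nat ?C = of_nat p * z"
    using scaled_surj_cong_binomial unfolding p_cong_def by blast
  then obtain a b where ab: "\<not> int p dvd b" "of_int b * z = of_int a"
    unfolding p_integral_def by blast
  have "(- of_nat p) ^ m * surj_count n k = fact n * scaled_surj ((p - 1) * m) k"
    using pred_prime_pos by (simp add: scaled_surj_def n_def)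
  also have "\<dots> = fact n * (of_nat ?C + of_nat p * z)"
    using z(2) by (simp add: algebra_simps)
  \<comment> \<open>Multiplying by the denominator \<open>b\<close> of \<open>z\<close> moves the
    identity to the integers, where valuations can be taken.\<close>
  finally have "of_int b * ((- of_nat p) ^ m * surj_count n k) =
      fact n * (of_int b * of_nat ?C + of_nat p * (of_int b * z))"
    by (simp add: algebra_simps)
  then have "(of_int (b * ((- int p) ^ m * int (fact k * Stirling n k))) :: rat) =
      of_int (fact n * (b * int ?C + int p * a))"
    by (simp add: ab(2) surj_count_def)
  then have eq: "b * ((- int p) ^ m * int (fact k * Stirling n k)) = fact n * (b * int ?C + int p * a)"
    by (simp only: of_int_eq_iff)
  have nd: "\<not> int p dvd b * int ?C + int p * a"
  proof
    assume "int p dvd b * int ?C + int p * a"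
    then have "int p dvd b * int ?C" by (simp add: dvd_add_left_iff)
    then show False using ab(1) assms(1) prime_int_p
      by (simp only: prime_dvd_mult_iff int_dvd_int_iff) blast
  qed
  then have nz: "b * int ?C + int p * a \<noteq> 0" by (metis dvd_0_right)
  have S: "Stirling n k \<noteq> 0"
  proof
    assume "Stirling n k = 0"
    then have "fact n * (b * int ?C + int p * a) = 0" unfolding eq[symmetric] by simp
    with nz show False by simp
  qed
  then show "Stirling n k > 0" by simp
  have "multiplicity (int p) (b * ((- int p) ^ m * int (fact k * Stirling n k))) =
      m + multiplicity p (fact k * Stirling n k)"
    (is "multiplicity _ (b * (?P * int ?F)) = _")
  proof -
    have "multiplicity (int p) (b * (?P * int ?F)) = multiplicity (int p) (?P * int ?F)"
      by (rule multiplicity_prime_elem_times_other[OF P ab(1)])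
    also have "\<dots> = multiplicity (int p) ?P + multiplicity (int p) (int ?F)"
      using S p0 by (intro prime_elem_multiplicity_mult_distrib[OF P]) auto
    also have "multiplicity (int p) ?P = m * multiplicity (int p) (- int p)"
      using p0 by (intro prime_elem_multiplicity_power_distrib[OF P]) auto
    also have "multiplicity (int p) (- int p) = 1"
      using P multiplicity_times_unit_right[of "-1" "int p" "int p"] by simp
    also have "multiplicity (int p) (int ?F) = multiplicity p ?F"
      using S by (intro multiplicity_of_nat_int) simp
    finally show ?thesis by simp
  qed
  moreover have "multiplicity (int p) (fact n * (b * int ?C + int p * a)) = multiplicity p (fact n)"
    (is "multiplicity _ (_ * ?D) = _")
    using multiplicity_prime_elem_times_other[OF P nd, of "fact n"]
      multiplicity_of_nat_int[of "fact n"] by (simp add: mult.commute[of _ ?D])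
  moreover have "multiplicity p (fact k * Stirling n k) = multiplicity p (fact k) + multiplicity p (Stirling n k)"
    using prime_p S by (intro prime_elem_multiplicity_mult_distrib) auto
  ultimately show "multiplicity p (fact n) = m + multiplicity p (fact k) + multiplicity p (Stirling n k)"
    using eq by simp
qed

section \<open>Digit sums and Legendre's formula\<close>

lemma digit_sum_rec: "digit_sum p m = m mod p + digit_sum p (m div p)"
proof -
  \<comment> \<open>The summation bound in \<open>digit_sum\<close> depends on the argument. Higher
    digits are zero, so any larger bound gives the same sum and \<open>m\<close> can be compared
    with \<open>m div p\<close>.\<close>
  have extend: "digit_sum p l = (\<Sum>i\<le>N. l div p ^ i mod p)" if "l \<le> N" for l N
    unfolding digit_sum_def
  proof (rule sum.mono_neutral_left)
    show "\<forall>i\<in>{..N} - {..l}. l div p ^ i mod p = 0"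
    proof
      fix i assume "i \<in> {..N} - {..l}"
      then have "l < i" by simp
      also have "i < p ^ i" using prime_gt_1_nat[OF prime_p] by (intro power_gt_expt) simp
      finally show "l div p ^ i mod p = 0" by simp
    qed
  qed (use that in auto)
  have "digit_sum p m = (\<Sum>i\<le>Suc m. m div p ^ i mod p)" by (rule extend) simp
  also have "\<dots> = m mod p + (\<Sum>i\<le>m. m div p div p ^ i mod p)"
    by (subst sum.atMost_Suc_shift) (simp add: div_mult2_eq)
  also have "(\<Sum>i\<le>m. m div p div p ^ i mod p) = digit_sum p (m div p)"
    by (rule extend[symmetric]) simp
  finally show ?thesis .
qed

text \<open>Adding 1 turns the trailing digits \<open>p - 1\<close> of \<open>m\<close> into zeros,
  and their number is the valuation of \<open>Suc m\<close>; the next digit rises by 1. The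
  induction strips one trailing digit at a time.\<close>

lemma digit_sum_Suc: "digit_sum p (Suc m) + (p - 1) * multiplicity p (Suc m) = Suc (digit_sum p m)"
proof (induction m rule: less_induct)
  case (less m)
  have p: "p > 1" using prime_p by (rule prime_gt_1_nat)
  show ?case
  proof (cases "p dvd Suc m")
    case True
    then obtain t where "Suc m = p * t" by blast
    moreover from this obtain s where "t = Suc s" by (cases t) auto
    ultimately have m: "Suc m = p * Suc s" by simp
    then have m': "m = p - 1 + p * s" using p by simp
    have "s \<le> p * s" using p by simp
    then have "s < m" using m' p by linarith
    have "digit_sum p (Suc m) = digit_sum p (Suc s)"
      unfolding m using p by (subst digit_sum_rec) simp
    moreover have "digit_sum p m = p - 1 + digit_sum p s"
    proof -
      have "m mod p = p - 1" unfolding m' using p by (subst mod_mult_self2) simp_all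
      moreover have "m div p = s" unfolding m' using p by (subst div_mult_self2) simp_all
      ultimately show ?thesis by (simp add: digit_sum_rec[of m])
    qed
    moreover have "multiplicity p (Suc m) = Suc (multiplicity p (Suc s))"
      unfolding m using p by (intro multiplicity_times_same) auto
    ultimately show ?thesis using less.IH[OF \<open>s < m\<close>] by simp
  next
    case False
    then have "Suc m mod p = Suc (m mod p)" "Suc m div p = m div p"
      by (auto simp: mod_Suc div_Suc dvd_eq_mod_eq_0 split: if_splits)
    with False show ?thesis
      by (simp add: digit_sum_rec[of "Suc m"] digit_sum_rec[of m] not_dvd_imp_multiplicity_0)
  qed
qed

lemma Legendre_formula: "(p - 1) * multiplicity p (fact m) + digit_sum p m = m"
proof (induction m)
  case 0
  then show ?case by (simp add: digit_sum_def)
next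
  case (Suc m)
  have "multiplicity p (fact (Suc m)) = multiplicity p (Suc m) + multiplicity p (fact m)"
    unfolding fact_Suc of_nat_id using prime_p by (intro prime_elem_multiplicity_mult_distrib) auto
  then show ?case using Suc digit_sum_Suc[of m] by (simp add: algebra_simps)
qed

lemma digit_sum_times_power:
  assumes "a < p"
  shows "digit_sum p (a * p ^ h) = a"
proof (induction h)
  case 0
  have "digit_sum p 0 = 0" by (simp add: digit_sum_def)
  then show ?case using assms digit_sum_rec[of a] by simp
next
  case (Suc h)
  then show ?case using assms digit_sum_rec[of "a * p ^ Suc h"] by (simp add: ac_simps)
qed

end

theorem theorem2p2:
  fixes p a h n k :: nat
  assumes "prime p"
    and "1 \<le> a" and "a \<le> p - 1"
    and "n = a * p ^ h"
    and "1 \<le> k" and "k \<le> n"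
    and "(p - 1) dvd (n - k)"
  shows "minimum_zero_case p n k \<and>
    real (multiplicity p (Stirling n k)) =
      (real (digit_sum p k) - real (digit_sum p n)) / (real p - 1) \<and>
    (real (digit_sum p k) - real (digit_sum p n)) / (real p - 1) =
      (real (digit_sum p k) - real a) / (real p - 1)"
proof -
  have p: "p > 1" using \<open>prime p\<close> by (rule prime_gt_1_nat)
  obtain m where "n - k = (p - 1) * m" using assms(7) by blast
  then have n: "n = k + (p - 1) * m" using \<open>k \<le> n\<close> by simp
  \<comment> \<open>\<open>(p - 1) * m = n - k\<close> is below \<open>n\<close> because
    \<open>k \<ge> 1\<close>, and \<open>n\<close> is at most
    \<open>(p - 1) * p ^ h\<close>.\<close>
  have "(p - 1) * m < (p - 1) * p ^ h"
    using n assms mult_right_mono[OF \<open>a \<le> p - 1\<close>, of "p ^ h"] by linarith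
  then have "m < p ^ h" by simp
  then have "\<not> p dvd (n + m choose m)"
    using assms by (intro not_dvd_binomial_add) auto
  moreover have "n + m = k + p * m" using n p by (cases p) auto
  ultimately have "\<not> p dvd (k + p * m choose m)" by simp
  from multiplicity_fact_Stirling[OF \<open>prime p\<close> this, folded n]
  have S: "Stirling n k > 0"
    and v: "multiplicity p (fact n) =
      m + multiplicity p (fact k) + multiplicity p (Stirling n k)" by auto
  \<comment> \<open>In the difference of Legendre's formulas for \<open>n\<close> and
    \<open>k\<close>, the term \<open>(p - 1) * m\<close> cancels against
    \<open>n - k\<close>.\<close>
  have "(p - 1) * multiplicity p (Stirling n k) + digit_sum p n = digit_sum p k"
    using Legendre_formula[OF \<open>prime p\<close>, of n] Legendre_formula[OF \<open>prime p\<close>, of k] n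
    unfolding v distrib_left by linarith
  then have "real ((p - 1) * multiplicity p (Stirling n k) + digit_sum p n) = real (digit_sum p k)"
    by simp
  then have "real (multiplicity p (Stirling n k)) =
      (real (digit_sum p k) - real (digit_sum p n)) / (real p - 1)"
    using p by (simp add: field_simps of_nat_diff)
  moreover have "digit_sum p n = a"
    using digit_sum_times_power[OF \<open>prime p\<close>] assms(3,4) p by simp
  ultimately show ?thesis
    using S unfolding minimum_zero_case_def by simp
qed

end
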